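(* Let $\{f_i\}_{i\in I}\subset\mathcal H$ be an adaptive resolution frame (AR-frame) for a separable Hilbert space $\mathcal H$ with frame bounds $A,B>0$, positive weights $\{\lambda_i\}_{i\in I}$ and partition $I=\bigcup_{k=1}^\infty I_k$, such that $\mathcal H=\bigoplus_{k=1}^\infty \mathcal H_k$ is an orthogonal decomposition, where $\mathcal H_k=\overline{\operatorname{span}}\{f_i: i\in I_k\}$, and each $\{f_i\}_{i\in I_k}$ is a frame for $\mathcal H_k$. Suppose that $\{g_i\}_{i\in I}\subset\mathcal H$ satisfies $$\sum_{k=1}^\infty\sum_{i\in I_k}\lambda_i\|f_i-g_i\|^2\le\delta^2,$$ where $0<\delta<\sqrt A$. Then $\{g_i\}_{i\in I}$, equipped with the same weights $\{\lambda_i\}_{i\in I}$ and the same partition $I=\bigcup_{k=1}^\infty I_k$, is also an AR-frame for $\mathcal H$. Moreover, its frame bounds are $(\sqrt A-\delta)^2$ and $(\sqrt B+\delta)^2$.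
   Context: $\mathcal H$ is a separable Hilbert space with inner product $\langle\cdot,\cdot\rangle$ and norm $\|\cdot\|$; $I$ is a countable index set. AR-frame: a family $\{f_i\}_{i\in I}\subset\mathcal H$, equipped with positive weights $\{\lambda_i\}_{i\in I}$ and a partition $I=\bigcup_{k=1}^\infty I_k$ with $I_k\cap I_j=\emptyset$ for $k\ne j$, is an adaptive resolution frame (AR-frame) for $\mathcal H$ if there exist constants $A,B>0$ such that $$A\|x\|^2\le \sum_{k=1}^\infty\sum_{i\in I_k}\lambda_i|\langle x,f_i\rangle|^2\le B\|x\|^2\qquad\text{for all }x\in\mathcal H.$$ Any constants $A,B$ for which this holds are called (lower and upper) frame bounds; they are not required to be optimal. *)

theory Defs
  imports "HOL-Analysis.Analysis"
begin

(* The scalar field of the Hilbert space is either the reals or the complex numbers.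
   A real subalgebra of the complex numbers is one of these two, so a normed field
   with an isometric embedding into the complex numbers is exactly one of them. *)
class real_or_complex = real_normed_field +
  fixes to_complex :: "'a \<Rightarrow> complex"
  assumes to_complex_add: "to_complex (a + b) = to_complex a + to_complex b"
    and to_complex_mult: "to_complex (a * b) = to_complex a * to_complex b"
    and to_complex_one: "to_complex 1 = 1"
    and to_complex_scaleR: "to_complex (r *\<^sub>R a) = r *\<^sub>R to_complex a"
    and cmod_to_complex: "cmod (to_complex a) = norm a"

instantiation real :: real_or_complex
begin
definition to_complex_real :: "real \<Rightarrow> complex" where "to_complex_real = complex_of_real"
instance by standard (simp_all add: to_complex_real_def scaleR_conv_of_real)
end

instantiation complex :: real_or_complex
begin
definition to_complex_complex :: "complex \<Rightarrow> complex" where "to_complex_complex z = z"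
instance by standard (simp_all add: to_complex_complex_def)
end

lemma range_to_complex:
  "range (to_complex :: 'k::real_or_complex \<Rightarrow> complex) = \<real> \<or>
   range (to_complex :: 'k \<Rightarrow> complex) = UNIV"
proof (cases "range (to_complex :: 'k \<Rightarrow> complex) \<subseteq> \<real>")
  case True
  moreover have "complex_of_real r \<in> range (to_complex :: 'k \<Rightarrow> complex)" for r
    using to_complex_scaleR[of r "1 :: 'k"]
    by (metis rangeI to_complex_one of_real_def)
  ultimately show ?thesis by (auto elim!: Reals_cases)
next
  case False
  then obtain a :: 'k where a: "Im (to_complex a) \<noteq> 0"
    unfolding complex_is_Real_iff subset_iff by blast
  have "z \<in> range (to_complex :: 'k \<Rightarrow> complex)" for z
  proof -
    define t where "t = Im z / Im (to_complex a)"
    define s where "s = Re z - t * Re (to_complex a)"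
    have "to_complex (s *\<^sub>R 1 + t *\<^sub>R a) = z"
      using a by (simp add: to_complex_add to_complex_scaleR to_complex_one
        s_def t_def complex_eq_iff)
    then show ?thesis by (metis rangeI)
  qed
  then show ?thesis by auto
qed

(* The inner product is linear in the first argument. Completeness and separability
   are carried by the sort of the vector type, whose norm and real scaling
   are required to be those of the Hilbert space structure. *)
locale separable_hilbert_space = vector_space sc
  for sc :: "'k::real_or_complex \<Rightarrow> 'v::{banach, second_countable_topology} \<Rightarrow> 'v" +
  fixes ip :: "'v \<Rightarrow> 'v \<Rightarrow> 'k"
  assumes scale_of_real: "sc (of_real r) x = r *\<^sub>R x"
    and ip_add_left: "ip (x + y) z = ip x z + ip y z"
    and ip_scale_left: "ip (sc a x) y = a * ip x y"
    and ip_cnj: "to_complex (ip y x) = cnj (to_complex (ip x y))"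
    and ip_self: "ip x x = of_real ((norm x)\<^sup>2)"

lemma separable_hilbert_space_real_inner:
  "separable_hilbert_space scaleR
     (inner :: 'v::{real_inner, banach, second_countable_topology} \<Rightarrow> 'v \<Rightarrow> real)"
  by unfold_locales
    (simp_all add: algebra_simps inner_add_left to_complex_real_def inner_commute
      power2_norm_eq_inner)

lemma separable_hilbert_space_complex:
  "separable_hilbert_space (*) (\<lambda>x y :: complex. x * cnj y)"
  by unfold_locales
    (simp_all add: algebra_simps to_complex_complex_def scaleR_conv_of_real
      complex_norm_square del: of_real_power)

(* Sums of nonnegative terms are taken in [0, \<infinity>], so that an upper bound
   includes the convergence of the series. *)

definition ar_frame_bounds ::
  "('v::real_normed_vector \<Rightarrow> 'v \<Rightarrow> 'k::real_normed_field) \<Rightarrow> (nat \<Rightarrow> 'i set) \<Rightarrow>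
   ('i \<Rightarrow> real) \<Rightarrow> ('i \<Rightarrow> 'v) \<Rightarrow> real \<Rightarrow> real \<Rightarrow> bool" where
  "ar_frame_bounds ip J w f A B \<longleftrightarrow> A > 0 \<and> B > 0 \<and>
     (\<forall>x. ennreal (A * (norm x)\<^sup>2)
            \<le> (\<Sum>\<^sub>\<infinity>k\<in>{1..}. \<Sum>\<^sub>\<infinity>i\<in>J k. ennreal (w i * (norm (ip x (f i)))\<^sup>2)) \<and>
          (\<Sum>\<^sub>\<infinity>k\<in>{1..}. \<Sum>\<^sub>\<infinity>i\<in>J k. ennreal (w i * (norm (ip x (f i)))\<^sup>2))
            \<le> ennreal (B * (norm x)\<^sup>2))"

(* The parts of the partition are J 1, J 2, ...; the value J 0 is irrelevant, and
   parts may be empty. *)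
definition ar_frame ::
  "('v::real_normed_vector \<Rightarrow> 'v \<Rightarrow> 'k::real_normed_field) \<Rightarrow> 'i set \<Rightarrow> (nat \<Rightarrow> 'i set) \<Rightarrow>
   ('i \<Rightarrow> real) \<Rightarrow> ('i \<Rightarrow> 'v) \<Rightarrow> bool" where
  "ar_frame ip I J w f \<longleftrightarrow>
     countable I \<and> (\<forall>i\<in>I. w i > 0) \<and>
     I = (\<Union>k\<in>{1..}. J k) \<and> disjoint_family_on J {1..} \<and>
     (\<exists>A B. ar_frame_bounds ip J w f A B)"

definition frame_for ::
  "('v::real_normed_vector \<Rightarrow> 'v \<Rightarrow> 'k::real_normed_field) \<Rightarrow> 'v set \<Rightarrow> 'i set \<Rightarrow>
   ('i \<Rightarrow> 'v) \<Rightarrow> bool" where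
  "frame_for ip M K f \<longleftrightarrow> f ` K \<subseteq> M \<and>
     (\<exists>a b. a > 0 \<and> b > 0 \<and>
       (\<forall>x\<in>M. ennreal (a * (norm x)\<^sup>2) \<le> (\<Sum>\<^sub>\<infinity>i\<in>K. ennreal ((norm (ip x (f i)))\<^sup>2)) \<and>
               (\<Sum>\<^sub>\<infinity>i\<in>K. ennreal ((norm (ip x (f i)))\<^sup>2)) \<le> ennreal (b * (norm x)\<^sup>2)))"

definition closed_span ::
  "('k::real_normed_field \<Rightarrow> 'v::real_normed_vector \<Rightarrow> 'v) \<Rightarrow> 'v set \<Rightarrow> 'v set" where
  "closed_span sc S = closure (module.span sc S)"

(* Uniqueness of the components y k follows from orthogonality. *)
definition orthogonal_decomposition ::
  "('v::real_normed_vector \<Rightarrow> 'v \<Rightarrow> 'k::real_normed_field) \<Rightarrow> (nat \<Rightarrow> 'v set) \<Rightarrow> bool" where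
  "orthogonal_decomposition ip M \<longleftrightarrow>
     (\<forall>j\<in>{1..}. \<forall>k\<in>{1..}. j \<noteq> k \<longrightarrow> (\<forall>x\<in>M j. \<forall>y\<in>M k. ip x y = 0)) \<and>
     (\<forall>x. \<exists>y. (\<forall>k\<in>{1..}. y k \<in> M k) \<and> (y has_sum x) {1..})"

end

theory Submission
  imports Defs
begin

text \<open>
  The AR-frame condition for a family \<open>f\<close> says that the weighted \<open>\<ell>\<^sup>2\<close>-norm of the coefficient family
  \<open>\<langle>x, f\<^sub>i\<rangle>\<close> lies between \<open>\<surd>A \<parallel>x\<parallel>\<close> and \<open>\<surd>B \<parallel>x\<parallel>\<close>. By the Cauchy-Schwarz inequality
  \<open>\<bar>\<langle>x, f\<^sub>i - g\<^sub>i\<rangle>\<bar> \<le> \<parallel>x\<parallel> \<parallel>f\<^sub>i - g\<^sub>i\<parallel>\<close>, the coefficients of \<open>f - g\<close> have weighted \<open>\<ell>\<^sup>2\<close>-norm at most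
  \<open>\<delta> \<parallel>x\<parallel>\<close>. The triangle inequality in weighted \<open>\<ell>\<^sup>2\<close>, applied to \<open>g = f - (f - g)\<close> and to
  \<open>f = g + (f - g)\<close>, then places the norm of the coefficients of \<open>g\<close> between \<open>(\<surd>A - \<delta>) \<parallel>x\<parallel>\<close> and
  \<open>(\<surd>B + \<delta>) \<parallel>x\<parallel>\<close>.

  Since the sums take values in \<open>[0, \<infinity>]\<close>, the triangle inequality is phrased with squared norms
  (\<open>weighted_energy_triangle\<close>); it comes from the pointwise bound
  \<open>(a + b)\<^sup>2 \<le> (1 + Q/P) a\<^sup>2 + (1 + P/Q) b\<^sup>2\<close>, whose right-hand side sums to at most \<open>(P + Q)\<^sup>2\<close> when
  the two families have norms at most \<open>P\<close> and \<open>Q\<close>. The lower bound for \<open>g\<close> is its contrapositive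
  (\<open>weighted_energy_reverse_triangle\<close>).
\<close>

section \<open>Sums in the extended nonnegative reals\<close>

lemma ennreal_summable_on: "(f :: 'a \<Rightarrow> ennreal) summable_on S"
  by (rule nonneg_summable_on_complete) simp

lemma infsum_ennreal_mono:
  fixes f g :: "'a \<Rightarrow> ennreal"
  assumes "\<And>x. x \<in> S \<Longrightarrow> f x \<le> g x"
  shows "infsum f S \<le> infsum g S"
  using assms by (intro infsum_mono ennreal_summable_on)

lemma infsum_ennreal_add:
  fixes f g :: "'a \<Rightarrow> ennreal"
  shows "(\<Sum>\<^sub>\<infinity>x\<in>S. f x + g x) = infsum f S + infsum g S"
  by (intro infsum_add ennreal_summable_on)

lemma infsum_ennreal_cmult:
  fixes f :: "'a \<Rightarrow> ennreal" and c :: real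
  shows "(\<Sum>\<^sub>\<infinity>x\<in>S. ennreal c * f x) = ennreal c * infsum f S"
proof (rule infsumI)
  have "(f has_sum infsum f S) S"
    by (intro has_sum_infsum ennreal_summable_on)
  then show "((\<lambda>x. ennreal c * f x) has_sum (ennreal c * infsum f S)) S"
    unfolding has_sum_def sum_distrib_left[symmetric]
    by (intro ennreal_tendsto_cmult) auto
qed

section \<open>The triangle inequality in a weighted sequence space\<close>

definition weighted_energy :: "(nat \<Rightarrow> 'i set) \<Rightarrow> ('i \<Rightarrow> real) \<Rightarrow> ('i \<Rightarrow> real) \<Rightarrow> ennreal" where
  "weighted_energy J w u = (\<Sum>\<^sub>\<infinity>k\<in>{1..}. \<Sum>\<^sub>\<infinity>i\<in>J k. ennreal (w i * (u i)\<^sup>2))"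

lemma weighted_energy_mono:
  assumes "\<And>k i. k \<ge> 1 \<Longrightarrow> i \<in> J k \<Longrightarrow> w i * (u i)\<^sup>2 \<le> w i * (v i)\<^sup>2"
  shows "weighted_energy J w u \<le> weighted_energy J w v"
  unfolding weighted_energy_def
  using assms by (intro infsum_ennreal_mono ennreal_leI) auto

lemma weighted_energy_scale:
  "weighted_energy J w (\<lambda>i. c * u i) = ennreal (c\<^sup>2) * weighted_energy J w u"
  unfolding weighted_energy_def infsum_ennreal_cmult[symmetric]
  by (intro infsum_cong) (simp add: ennreal_mult'[symmetric] power_mult_distrib ac_simps)

text \<open>
  Expanding \<open>(a + b)\<^sup>2\<close> leaves the mixed term \<open>2ab\<close>, which the arithmetic-geometric mean inequality
  splits as \<open>t a\<^sup>2 + b\<^sup>2/t\<close>; the free parameter \<open>t\<close> is what makes a sharp estimate of a sum possible.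
\<close>

lemma power2_add_le_weighted:
  fixes a b t :: real
  assumes "t > 0"
  shows "(a + b)\<^sup>2 \<le> (1 + t) * a\<^sup>2 + (1 + 1 / t) * b\<^sup>2"
proof -
  have "(1 + t) * a\<^sup>2 + (1 + 1 / t) * b\<^sup>2 - (a + b)\<^sup>2 = (t * a - b)\<^sup>2 / t"
    using assms by (simp add: field_simps power2_eq_square)
  also have "\<dots> \<ge> 0" using assms by simp
  finally show ?thesis by simp
qed

lemma weighted_energy_add_le:
  assumes "t > 0"
    and "\<And>k i. k \<ge> 1 \<Longrightarrow> i \<in> J k \<Longrightarrow> 0 \<le> w i"
    and "\<And>k i. k \<ge> 1 \<Longrightarrow> i \<in> J k \<Longrightarrow> \<bar>u i\<bar> \<le> \<bar>v i\<bar> + \<bar>z i\<bar>"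
  shows "weighted_energy J w u
    \<le> ennreal (1 + t) * weighted_energy J w v + ennreal (1 + 1 / t) * weighted_energy J w z"
proof -
  have "ennreal (w i * (u i)\<^sup>2)
      \<le> ennreal (1 + t) * ennreal (w i * (v i)\<^sup>2) + ennreal (1 + 1 / t) * ennreal (w i * (z i)\<^sup>2)"
    if "k \<ge> 1" "i \<in> J k" for k i
  proof -
    have w: "0 \<le> w i" using assms(2) that by blast
    have "(u i)\<^sup>2 \<le> (\<bar>v i\<bar> + \<bar>z i\<bar>)\<^sup>2"
      using assms(3)[OF that] by (metis abs_ge_zero power2_abs power_mono)
    also have "\<dots> \<le> (1 + t) * (v i)\<^sup>2 + (1 + 1 / t) * (z i)\<^sup>2"
      using power2_add_le_weighted[OF assms(1), of "\<bar>v i\<bar>" "\<bar>z i\<bar>"] by simp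
    finally have "w i * (u i)\<^sup>2 \<le> w i * ((1 + t) * (v i)\<^sup>2 + (1 + 1 / t) * (z i)\<^sup>2)"
      using w by (rule mult_left_mono)
    also have "\<dots> = (1 + t) * (w i * (v i)\<^sup>2) + (1 + 1 / t) * (w i * (z i)\<^sup>2)"
      by (simp add: algebra_simps)
    finally have "ennreal (w i * (u i)\<^sup>2)
        \<le> ennreal ((1 + t) * (w i * (v i)\<^sup>2) + (1 + 1 / t) * (w i * (z i)\<^sup>2))"
      by (rule ennreal_leI)
    also have "\<dots> = ennreal ((1 + t) * (w i * (v i)\<^sup>2)) + ennreal ((1 + 1 / t) * (w i * (z i)\<^sup>2))"
      using w assms(1) by (intro ennreal_plus) auto
    finally show ?thesis
      using w assms(1) by (simp add: ennreal_mult)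
  qed
  then show ?thesis
    unfolding weighted_energy_def infsum_ennreal_cmult[symmetric] infsum_ennreal_add[symmetric]
    by (intro infsum_ennreal_mono) auto
qed

text \<open>
  The choice \<open>t = Q / P\<close> minimises \<open>(1 + t) P\<^sup>2 + (1 + 1/t) Q\<^sup>2\<close>, with minimum \<open>(P + Q)\<^sup>2\<close>. Thus the
  usual triangle inequality for norms is obtained without square roots of possibly infinite sums.
\<close>

lemma weighted_energy_triangle:
  assumes "P > 0" "Q > 0"
    and "\<And>k i. k \<ge> 1 \<Longrightarrow> i \<in> J k \<Longrightarrow> 0 \<le> w i"
    and "\<And>k i. k \<ge> 1 \<Longrightarrow> i \<in> J k \<Longrightarrow> \<bar>u i\<bar> \<le> \<bar>v i\<bar> + \<bar>z i\<bar>"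
    and "weighted_energy J w v \<le> ennreal (P\<^sup>2)"
    and "weighted_energy J w z \<le> ennreal (Q\<^sup>2)"
  shows "weighted_energy J w u \<le> ennreal ((P + Q)\<^sup>2)"
proof -
  have "weighted_energy J w u
      \<le> ennreal (1 + Q / P) * weighted_energy J w v
        + ennreal (1 + 1 / (Q / P)) * weighted_energy J w z"
    using assms(1-4) by (intro weighted_energy_add_le) auto
  also have "\<dots> \<le> ennreal (1 + Q / P) * ennreal (P\<^sup>2) + ennreal (1 + 1 / (Q / P)) * ennreal (Q\<^sup>2)"
    using assms(5,6) by (intro add_mono mult_left_mono) auto
  also have "\<dots> = ennreal ((1 + Q / P) * P\<^sup>2 + (1 + 1 / (Q / P)) * Q\<^sup>2)"
    using assms(1,2) by (simp add: ennreal_mult ennreal_plus)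
  also have "(1 + Q / P) * P\<^sup>2 + (1 + 1 / (Q / P)) * Q\<^sup>2 = (P + Q)\<^sup>2"
    using assms(1,2) by (simp add: field_simps power2_eq_square)
  finally show ?thesis .
qed

text \<open>
  If \<open>v\<close> had norm below \<open>P - Q\<close>, it would have norm at most some \<open>R < P - Q\<close>, and the triangle
  inequality would bound the norm of \<open>u\<close> by \<open>R + Q < P\<close>.
\<close>

lemma weighted_energy_reverse_triangle:
  assumes "Q > 0" "Q < P"
    and "\<And>k i. k \<ge> 1 \<Longrightarrow> i \<in> J k \<Longrightarrow> 0 \<le> w i"
    and "\<And>k i. k \<ge> 1 \<Longrightarrow> i \<in> J k \<Longrightarrow> \<bar>u i\<bar> \<le> \<bar>v i\<bar> + \<bar>z i\<bar>"
    and "ennreal (P\<^sup>2) \<le> weighted_energy J w u"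
    and "weighted_energy J w z \<le> ennreal (Q\<^sup>2)"
  shows "ennreal ((P - Q)\<^sup>2) \<le> weighted_energy J w v"
proof (rule ccontr)
  assume "\<not> ?thesis"
  then have "weighted_energy J w v < ennreal ((P - Q)\<^sup>2)" by simp
  \<comment> \<open>Lying strictly above an energy makes \<open>r\<close> positive even if the energy is zero, so \<open>R > 0\<close>.\<close>
  then obtain r where r: "weighted_energy J w v < r" "r < ennreal ((P - Q)\<^sup>2)"
    using dense by blast
  define R where "R = sqrt (enn2real r)"
  have fin: "r < top" using r(2) by (rule order_less_trans) simp
  have pos: "0 < enn2real r"
    using r(1) fin by (metis enn2real_positive_iff gr_zeroI not_less_zero)
  have R: "R > 0" and R2: "ennreal (R\<^sup>2) = r"
    using pos fin by (auto simp: R_def)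
  have "R\<^sup>2 < (P - Q)\<^sup>2"
    using r(2) R2 by (metis ennreal_less_iff zero_le_power2)
  then have "R < P - Q" using assms(2) by (simp add: power2_less_imp_less)
  then have "(R + Q)\<^sup>2 < P\<^sup>2"
    using R assms(1) by (intro power_strict_mono) auto
  moreover have "weighted_energy J w u \<le> ennreal ((R + Q)\<^sup>2)"
    using assms(1,3,4,6) R R2 r(1) by (intro weighted_energy_triangle[where v = v and z = z]) auto
  then have "P\<^sup>2 \<le> (R + Q)\<^sup>2"
    using assms(5) by (metis ennreal_le_iff order_trans zero_le_power2)
  ultimately show False by simp
qed

section \<open>The inner product\<close>

lemma to_complex_diff: "to_complex (a - b) = to_complex a - to_complex b"
  by (metis add_diff_cancel_right' diff_add_cancel to_complex_add)

lemma to_complex_eq_iff: "to_complex a = to_complex b \<longleftrightarrow> a = b"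
proof
  assume "to_complex a = to_complex b"
  then have "norm (a - b) = 0"
    by (metis cmod_to_complex diff_self norm_zero to_complex_diff)
  then show "a = b" by simp
qed simp

lemma to_complex_of_real: "to_complex (of_real r) = of_real r"
  by (simp add: of_real_def to_complex_scaleR to_complex_one)

context separable_hilbert_space
begin

lemma ip_diff_left: "ip (x - y) z = ip x z - ip y z"
  by (metis add_diff_cancel_right' diff_add_cancel ip_add_left)

lemma ip_diff_right: "ip x (y - z) = ip x y - ip x z"
proof -
  have "to_complex (ip x (y - z)) = to_complex (ip x y - ip x z)"
    unfolding to_complex_diff ip_cnj[of x] ip_diff_left by simp
  then show ?thesis by (simp only: to_complex_eq_iff)
qed

text \<open>
  The vector \<open>z = \<parallel>y\<parallel>\<^sup>2 x - \<langle>x, y\<rangle> y\<close> is orthogonal to \<open>y\<close>, hence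
  \<open>\<parallel>z\<parallel>\<^sup>2 = \<parallel>y\<parallel>\<^sup>2 (\<parallel>y\<parallel>\<^sup>2 \<parallel>x\<parallel>\<^sup>2 - \<bar>\<langle>x, y\<rangle>\<bar>\<^sup>2)\<close>, and this is nonnegative.
\<close>

lemma Cauchy_Schwarz: "norm (ip x y) \<le> norm x * norm y"
proof (cases "y = 0")
  case True
  have "ip x 0 = 0" using ip_diff_right[of x 0 0] by simp
  then show ?thesis using True by simp
next
  case False
  define n where "n = (norm y)\<^sup>2"
  have n: "n > 0" using False by (simp add: n_def)
  define z where "z = sc (of_real n) x - sc (ip x y) y"
  have "ip z y = 0"
    by (simp add: z_def ip_diff_left ip_scale_left ip_self n_def)
  then have yz: "ip y z = 0"
    using ip_cnj[of y z] to_complex_eq_iff[of "ip y z" 0] to_complex_diff[of "0::'k" 0] by simp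
  have zx: "ip z x = of_real (n * (norm x)\<^sup>2) - ip x y * ip y x"
    by (simp add: z_def ip_diff_left ip_scale_left ip_self)
  have xyyx: "to_complex (ip x y * ip y x) = of_real ((norm (ip x y))\<^sup>2)"
    unfolding to_complex_mult ip_cnj[of y x] complex_norm_square[symmetric] cmod_to_complex ..
  have "to_complex (ip z x) = of_real (n * (norm x)\<^sup>2 - (norm (ip x y))\<^sup>2)"
    unfolding zx to_complex_diff xyyx to_complex_of_real by simp
  then have xz: "to_complex (ip x z) = of_real (n * (norm x)\<^sup>2 - (norm (ip x y))\<^sup>2)"
    using ip_cnj[of x z] by simp
  have "ip z z = of_real n * ip x z"
    using yz by (subst (1) z_def) (simp add: ip_diff_left ip_scale_left)
  then have "to_complex (of_real ((norm z)\<^sup>2) :: 'k) = to_complex (of_real n * ip x z)"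
    by (simp only: ip_self)
  then have "complex_of_real ((norm z)\<^sup>2) = of_real (n * (n * (norm x)\<^sup>2 - (norm (ip x y))\<^sup>2))"
    unfolding to_complex_mult xz to_complex_of_real by (simp only: of_real_mult)
  then have "(norm z)\<^sup>2 = n * (n * (norm x)\<^sup>2 - (norm (ip x y))\<^sup>2)"
    by (simp only: of_real_eq_iff)
  then have "0 \<le> n * (n * (norm x)\<^sup>2 - (norm (ip x y))\<^sup>2)"
    by (metis zero_le_power2)
  then have "(norm (ip x y))\<^sup>2 \<le> (norm x * norm y)\<^sup>2"
    using n by (simp add: zero_le_mult_iff n_def power_mult_distrib mult.commute)
  then show ?thesis by (rule power2_le_imp_le) simp
qed

section \<open>Perturbation of frame coefficients\<close>

lemma coefficient_energy_perturbation_le: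
  assumes "\<And>k i. k \<ge> 1 \<Longrightarrow> i \<in> J k \<Longrightarrow> 0 \<le> w i"
    and "weighted_energy J w (\<lambda>i. norm (f i - g i)) \<le> ennreal (\<delta>\<^sup>2)"
  shows "weighted_energy J w (\<lambda>i. norm (ip x (f i - g i))) \<le> ennreal ((\<delta> * norm x)\<^sup>2)"
proof -
  have "weighted_energy J w (\<lambda>i. norm (ip x (f i - g i)))
      \<le> weighted_energy J w (\<lambda>i. norm x * norm (f i - g i))"
    using assms(1) Cauchy_Schwarz by (intro weighted_energy_mono mult_left_mono power_mono) auto
  also have "\<dots> \<le> ennreal ((norm x)\<^sup>2) * ennreal (\<delta>\<^sup>2)"
    unfolding weighted_energy_scale using assms(2) by (intro mult_left_mono) auto
  also have "\<dots> = ennreal ((\<delta> * norm x)\<^sup>2)"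
    by (simp add: ennreal_mult[symmetric] power_mult_distrib mult.commute)
  finally show ?thesis .
qed

lemma ar_frame_bounds_perturbation:
  assumes w: "\<And>k i. k \<ge> 1 \<Longrightarrow> i \<in> J k \<Longrightarrow> 0 \<le> w i"
    and f: "ar_frame_bounds ip J w f A B"
    and fg: "weighted_energy J w (\<lambda>i. norm (f i - g i)) \<le> ennreal (\<delta>\<^sup>2)"
    and \<delta>: "0 < \<delta>" "\<delta> < sqrt A"
  shows "ar_frame_bounds ip J w g ((sqrt A - \<delta>)\<^sup>2) ((sqrt B + \<delta>)\<^sup>2)"
proof -
  let ?E = "\<lambda>h x. weighted_energy J w (\<lambda>i. norm (ip x (h i)))"
  have A: "A > 0" and B: "B > 0"
    and lower: "\<And>x. ennreal (A * (norm x)\<^sup>2) \<le> ?E f x"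
    and upper: "\<And>x. ?E f x \<le> ennreal (B * (norm x)\<^sup>2)"
    using f by (auto simp: ar_frame_bounds_def weighted_energy_def)
  have "ennreal ((sqrt A - \<delta>)\<^sup>2 * (norm x)\<^sup>2) \<le> ?E g x \<and>
      ?E g x \<le> ennreal ((sqrt B + \<delta>)\<^sup>2 * (norm x)\<^sup>2)" for x
  \<comment> \<open>The triangle inequality above takes positive bounds \<open>P\<close> and \<open>Q\<close>, hence \<open>x = 0\<close> is separate.\<close>
  proof (cases "x = 0")
    case True
    have "ip 0 y = 0" for y using ip_diff_left[of 0 0 y] by simp
    then show ?thesis using True by (simp add: weighted_energy_def)
  next
    case False
    then have x: "norm x > 0" by simp
    have diff: "?E (\<lambda>i. f i - g i) x \<le> ennreal ((\<delta> * norm x)\<^sup>2)"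
      using w fg by (rule coefficient_energy_perturbation_le)
    have g_le: "\<bar>norm (ip x (g i))\<bar> \<le> \<bar>norm (ip x (f i))\<bar> + \<bar>norm (ip x (f i - g i))\<bar>" for i
      using norm_triangle_ineq4[of "ip x (f i)" "ip x (f i - g i)"] by (simp add: ip_diff_right)
    have f_le: "\<bar>norm (ip x (f i))\<bar> \<le> \<bar>norm (ip x (g i))\<bar> + \<bar>norm (ip x (f i - g i))\<bar>" for i
      using norm_triangle_ineq[of "ip x (g i)" "ip x (f i - g i)"] by (simp add: ip_diff_right)
    have "?E g x \<le> ennreal ((sqrt B * norm x + \<delta> * norm x)\<^sup>2)"
    proof (rule weighted_energy_triangle[OF _ _ w g_le _ diff])
      show "?E f x \<le> ennreal ((sqrt B * norm x)\<^sup>2)"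
        using upper[of x] B by (simp add: power_mult_distrib)
    qed (use x B \<delta> in auto)
    moreover have "ennreal ((sqrt A * norm x - \<delta> * norm x)\<^sup>2) \<le> ?E g x"
    proof (rule weighted_energy_reverse_triangle[OF _ _ w f_le _ diff])
      show "ennreal ((sqrt A * norm x)\<^sup>2) \<le> ?E f x"
        using lower[of x] A by (simp add: power_mult_distrib)
    qed (use x \<delta> in auto)
    ultimately show ?thesis
      by (simp add: power_mult_distrib[symmetric] algebra_simps)
  qed
  moreover have "(sqrt A - \<delta>)\<^sup>2 > 0" "(sqrt B + \<delta>)\<^sup>2 > 0"
    using \<delta> B by (auto simp: zero_less_power2 add_nonneg_eq_0_iff)
  ultimately show ?thesis
    unfolding ar_frame_bounds_def weighted_energy_def by blast
qed

end

theorem proposition2p5: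
  fixes sc :: "'k::real_or_complex \<Rightarrow> 'v::{banach, second_countable_topology} \<Rightarrow> 'v"
    and ip :: "'v \<Rightarrow> 'v \<Rightarrow> 'k"
    and I :: "'i set" and J :: "nat \<Rightarrow> 'i set" and w :: "'i \<Rightarrow> real"
    and f g :: "'i \<Rightarrow> 'v" and A B \<delta> :: real
  assumes "separable_hilbert_space sc ip"
    and "ar_frame ip I J w f"
    and "ar_frame_bounds ip J w f A B"
    and "orthogonal_decomposition ip (\<lambda>k. closed_span sc (f ` J k))"
    and "\<And>k. k \<ge> 1 \<Longrightarrow> frame_for ip (closed_span sc (f ` J k)) (J k) f"
    and "(\<Sum>\<^sub>\<infinity>k\<in>{1..}. \<Sum>\<^sub>\<infinity>i\<in>J k. ennreal (w i * (norm (f i - g i))\<^sup>2)) \<le> ennreal (\<delta>\<^sup>2)"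
    and "0 < \<delta>" and "\<delta> < sqrt A"
  shows "ar_frame ip I J w g \<and>
         ar_frame_bounds ip J w g ((sqrt A - \<delta>)\<^sup>2) ((sqrt B + \<delta>)\<^sup>2)"
proof -
  interpret separable_hilbert_space sc ip by fact
  have w: "0 \<le> w i" if "k \<ge> 1" "i \<in> J k" for k i
    using assms(2) that unfolding ar_frame_def by (force intro: less_imp_le)
  have "ar_frame_bounds ip J w g ((sqrt A - \<delta>)\<^sup>2) ((sqrt B + \<delta>)\<^sup>2)"
    using w assms(3) assms(6)[folded weighted_energy_def] assms(7,8)
    by (rule ar_frame_bounds_perturbation)
  then show ?thesis
    using assms(2) unfolding ar_frame_def by blast
qed

end
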